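(* If $f,g\in\mathcal H$ then $\widehat f,\widehat g\in l^2_{\mathcal U}$ and $\widehat f_{\ast},\widehat g_{\ast}\in l^2_{\mathcal V}$, and the inner products of $l^2_{\mathcal U}$ and $l^2_{\mathcal V}$ take the form $$(\widehat f,\widehat g)_{l^2_{\mathcal U}}=\sum_{\xi\in I}\widehat f(\xi)\,\overline{\widehat g_{\ast}(\xi)},\qquad (\widehat f_{\ast},\widehat g_{\ast})_{l^2_{\mathcal V}}=\sum_{\xi\in I}\widehat f_{\ast}(\xi)\,\overline{\widehat g(\xi)} .$$ In particular, $$\overline{(\widehat f,\widehat g)_{l^2_{\mathcal U}}}=(\widehat g_{\ast},\widehat f_{\ast})_{l^2_{\mathcal V}} .$$ The Parseval identity takes the form $$(f,g)_{\mathcal H}=(\widehat f,\widehat g)_{l^2_{\mathcal U}}=\sum_{\xi\in I}\widehat f(\xi)\,\overline{\widehat g_{\ast}(\xi)} .$$ Furthermore, for any $f\in\mathcal H$ we have $\widehat f\in l^2_{\mathcal U}$, $\widehat f_{\ast}\in l^2_{\mathcal V}$, and $$\|f\|_{\mathcal H}=\|\widehat f\|_{l^2_{\mathcal U}}=\|\widehat f_{\ast}\|_{l^2_{\mathcal V}} .$$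
   Context: $\mathcal H$ is a separable complex Hilbert space with inner product $(\cdot,\cdot)=(\cdot,\cdot)_{\mathcal H}$, linear in the first argument. $I$ is a discrete (countable) index set. $\mathcal U=\{u_\xi\}_{\xi\in I}$ is a Riesz basis of $\mathcal H$, and $\mathcal V=\{v_\xi\}_{\xi\in I}\subset\mathcal H$ is the system biorthogonal to $\mathcal U$: $(u_\xi,v_\eta)=\delta_{\xi\eta}$; then $\mathcal V$ is also a Riesz basis of $\mathcal H$. For $f\in\mathcal H$, $\mathcal F_{\mathcal U}f(\xi)=\widehat f(\xi):=(f,v_\xi)$ and $\mathcal F_{\mathcal V}f(\xi)=\widehat f_{\ast}(\xi):=(f,u_\xi)$, with inverses $\mathcal F_{\mathcal U}^{-1}a=\sum_{\xi\in I}a(\xi)u_\xi$ and $\mathcal F_{\mathcal V}^{-1}a=\sum_{\xi\in I}a(\xi)v_\xi$. $l^2_{\mathcal U}$ is the linear space of functions $a:I\to\mathbb C$ such that $\mathcal F_{\mathcal U}^{-1}a\in\mathcal H$, i.e. $a=\mathcal F_{\mathcal U}f$ for some $f\in\mathcal H$, with inner product $$(a,b)_{l^2_{\mathcal U}}:=\sum_{\xi\in I}a(\xi)\,\overline{(\mathcal F_{\mathcal V}\circ\mathcal F_{\mathcal U}^{-1}b)(\xi)}$$ and norm $\|a\|_{l^2_{\mathcal U}}=(a,a)_{l^2_{\mathcal U}}^{1/2}$. Analogously, $l^2_{\mathcal V}$ is the space of functions $a:I\to\mathbb C$ such that $\mathcal F_{\mathcal V}^{-1}a\in\mathcal H$,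 with inner product $$(a,b)_{l^2_{\mathcal V}}:=\sum_{\xi\in I}a(\xi)\,\overline{(\mathcal F_{\mathcal U}\circ\mathcal F_{\mathcal V}^{-1}b)(\xi)}$$ and norm $\|a\|_{l^2_{\mathcal V}}=(a,a)_{l^2_{\mathcal V}}^{1/2}$. *)

theory Defs
  imports "HOL-Analysis.Analysis"
begin

section \<open>Complex Hilbert spaces\<close>

class complex_vector = real_vector +
  fixes scaleC :: "complex \<Rightarrow> 'a \<Rightarrow> 'a" (infixr "*\<^sub>C" 75)
  assumes scaleC_add_right: "c *\<^sub>C (x + y) = c *\<^sub>C x + c *\<^sub>C y"
    and scaleC_add_left: "(c + d) *\<^sub>C x = c *\<^sub>C x + d *\<^sub>C x"
    and scaleC_scaleC: "c *\<^sub>C d *\<^sub>C x = (c * d) *\<^sub>C x"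
    and scaleC_one: "1 *\<^sub>C x = x"
    and scaleR_scaleC: "r *\<^sub>R x = complex_of_real r *\<^sub>C x"

global_interpretation complex_vector: vector_space "scaleC :: complex \<Rightarrow> 'a \<Rightarrow> 'a::complex_vector"
  by unfold_locales (simp_all add: scaleC_add_right scaleC_add_left scaleC_scaleC scaleC_one)

text \<open>The inner product is linear in its first argument. Definiteness is not listed because
  it follows from \<open>norm_eq_sqrt_cinner\<close>.\<close>

class complex_inner = complex_vector + real_normed_vector +
  fixes cinner :: "'a \<Rightarrow> 'a \<Rightarrow> complex"
  assumes cinner_commute: "cinner x y = cnj (cinner y x)"
    and cinner_add_left: "cinner (x + y) z = cinner x z + cinner y z"
    and cinner_scaleC_left: "cinner (c *\<^sub>C x) y = c * cinner x y"
    and cinner_ge_zero: "0 \<le> Re (cinner x x)"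
    and norm_eq_sqrt_cinner: "norm x = sqrt (Re (cinner x x))"

class chilbert_space = complex_inner + complete_space

instantiation complex :: chilbert_space
begin
definition scaleC_complex :: "complex \<Rightarrow> complex \<Rightarrow> complex"
  where "scaleC_complex c x = c * x"
definition cinner_complex :: "complex \<Rightarrow> complex \<Rightarrow> complex"
  where "cinner_complex x y = x * cnj y"
instance
  by standard
    (simp_all add: scaleC_complex_def cinner_complex_def algebra_simps scaleR_conv_of_real
      complex_norm_square [symmetric] cmod_def power2_eq_square)
end

definition bounded_clinear :: "('a::complex_inner \<Rightarrow> 'b::complex_inner) \<Rightarrow> bool"
  where "bounded_clinear T \<longleftrightarrow> bounded_linear T \<and> (\<forall>c x. T (c *\<^sub>C x) = c *\<^sub>C T x)"

section \<open>Riesz bases\<close>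

text \<open>A system indexed by \<open>I\<close> is a function on the index type of which only the values on
  \<open>I\<close> matter; the same holds for the coefficient functions below.\<close>

definition orthonormal_basis :: "'i set \<Rightarrow> ('i \<Rightarrow> 'a::complex_inner) \<Rightarrow> bool"
  where "orthonormal_basis I e \<longleftrightarrow>
    (\<forall>\<xi>\<in>I. \<forall>\<eta>\<in>I. cinner (e \<xi>) (e \<eta>) = (if \<xi> = \<eta> then 1 else 0)) \<and>
    closure (complex_vector.span (e ` I)) = UNIV"

text \<open>A Riesz basis is the image of an orthonormal basis under a bounded linear operator
  with bounded inverse.\<close>

definition riesz_basis :: "'i set \<Rightarrow> ('i \<Rightarrow> 'a::complex_inner) \<Rightarrow> bool"
  where "riesz_basis I u \<longleftrightarrow>
    (\<exists>(e :: 'i \<Rightarrow> 'a) (T :: 'a \<Rightarrow> 'a) S. orthonormal_basis I e \<and>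
      bounded_clinear T \<and> bounded_clinear S \<and> S \<circ> T = id \<and> T \<circ> S = id \<and>
      (\<forall>\<xi>\<in>I. u \<xi> = T (e \<xi>)))"

definition biorthogonal :: "'i set \<Rightarrow> ('i \<Rightarrow> 'a::complex_inner) \<Rightarrow> ('i \<Rightarrow> 'a) \<Rightarrow> bool"
  where "biorthogonal I u v \<longleftrightarrow>
    (\<forall>\<xi>\<in>I. \<forall>\<eta>\<in>I. cinner (u \<xi>) (v \<eta>) = (if \<xi> = \<eta> then 1 else 0))"

section \<open>Fourier transforms and sequence spaces\<close>

text \<open>For a Riesz basis \<open>\<U> = u\<close> with biorthogonal system \<open>\<V> = v\<close>, the transforms cross over:
  \<open>\<F>\<^sub>\<U> f = coeff_along v f\<close> (written \<open>f\<close> hat) and \<open>\<F>\<^sub>\<V> f = coeff_along u f\<close>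
  (written \<open>f\<close> hat star), with inverses \<open>\<F>\<^sub>\<U>\<inverse> = synthesis I u\<close>
  and \<open>\<F>\<^sub>\<V>\<inverse> = synthesis I v\<close>.\<close>

definition coeff_along :: "('i \<Rightarrow> 'a::complex_inner) \<Rightarrow> 'a \<Rightarrow> 'i \<Rightarrow> complex"
  where "coeff_along w f \<xi> = cinner f (w \<xi>)"

definition synthesis :: "'i set \<Rightarrow> ('i \<Rightarrow> 'a::complex_inner) \<Rightarrow> ('i \<Rightarrow> complex) \<Rightarrow> 'a"
  where "synthesis I w a = (\<Sum>\<^sub>\<infinity>\<xi>\<in>I. a \<xi> *\<^sub>C w \<xi>)"

text \<open>\<open>l2_space I u\<close> is \<open>l\<^sup>2\<^sub>\<U>\<close> and \<open>l2_space I v\<close> is \<open>l\<^sup>2\<^sub>\<V>\<close>: the series defining the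
  inverse transform has to converge in the Hilbert space.\<close>

definition l2_space :: "'i set \<Rightarrow> ('i \<Rightarrow> 'a::complex_inner) \<Rightarrow> ('i \<Rightarrow> complex) set"
  where "l2_space I w = {a. (\<lambda>\<xi>. a \<xi> *\<^sub>C w \<xi>) summable_on I}"

text \<open>For \<open>w = u\<close> the second factor is \<open>\<F>\<^sub>\<V> (\<F>\<^sub>\<U>\<inverse> b)\<close>, for \<open>w = v\<close> it is
  \<open>\<F>\<^sub>\<U> (\<F>\<^sub>\<V>\<inverse> b)\<close>; in both cases only one of the two systems occurs.\<close>

definition l2_inner ::
    "'i set \<Rightarrow> ('i \<Rightarrow> 'a::complex_inner) \<Rightarrow> ('i \<Rightarrow> complex) \<Rightarrow> ('i \<Rightarrow> complex) \<Rightarrow> complex"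
  where "l2_inner I w a b = (\<Sum>\<^sub>\<infinity>\<xi>\<in>I. a \<xi> * cnj (coeff_along w (synthesis I w b) \<xi>))"

definition l2_norm :: "'i set \<Rightarrow> ('i \<Rightarrow> 'a::complex_inner) \<Rightarrow> ('i \<Rightarrow> complex) \<Rightarrow> real"
  where "l2_norm I w a = sqrt (Re (l2_inner I w a a))"

end

theory Submission
  imports Defs
begin

text \<open>Everything follows from the two unconditionally convergent expansions
  \<open>f = \<Sum> (f, v\<^sub>\<xi>) u\<^sub>\<xi>\<close> and \<open>f = \<Sum> (f, u\<^sub>\<xi>) v\<^sub>\<xi>\<close> by taking inner products termwise.
  For \<open>u\<^sub>\<xi> = T e\<^sub>\<xi>\<close> with \<open>S = T\<inverse>\<close>, applying \<open>T\<close> to the orthonormal expansion of \<open>S f\<close> gives the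
  first one, and biorthogonality identifies its coefficients. For the second, duality replaces
  the adjoints of \<open>S\<close> and \<open>T\<close>: it bounds the partial sums \<open>\<Sum> c\<^sub>\<xi> v\<^sub>\<xi>\<close> by the \<open>l\<^sup>2\<close> norm of \<open>c\<close>, and it
  shows that \<open>(f, u\<^sub>\<xi>)\<close> is square summable. So the series converges, and its sum has the same
  inner products with all \<open>u\<^sub>\<xi>\<close> as \<open>f\<close> does.\<close>

section \<open>Inner products\<close>

lemma cinner_add_right: "cinner x (y + z) = cinner x y + cinner x z"
  by (metis cinner_add_left cinner_commute complex_cnj_add)

lemma cinner_scaleC_right: "cinner x (c *\<^sub>C y) = cnj c * cinner x y"
  by (metis cinner_commute cinner_scaleC_left complex_cnj_mult)

lemma cinner_zero_left [simp]: "cinner 0 y = 0"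
  using cinner_add_left [of 0 0 y] by simp

lemma cinner_zero_right [simp]: "cinner x 0 = 0"
  using cinner_add_right [of x 0 0] by simp

lemma cinner_minus_left: "cinner (- x) y = - cinner x y"
  using cinner_add_left [of x "- x" y] by (simp add: eq_neg_iff_add_eq_0 add.commute)

lemma cinner_minus_right: "cinner x (- y) = - cinner x y"
  using cinner_add_right [of x y "- y"] by (simp add: eq_neg_iff_add_eq_0 add.commute)

lemma cinner_diff_left: "cinner (x - y) z = cinner x z - cinner y z"
  using cinner_add_left [of x "- y" z] by (simp add: cinner_minus_left)

lemma cinner_diff_right: "cinner x (y - z) = cinner x y - cinner x z"
  using cinner_add_right [of x y "- z"] by (simp add: cinner_minus_right)

lemma cinner_sum_left: "cinner (\<Sum>i\<in>F. f i) y = (\<Sum>i\<in>F. cinner (f i) y)"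
  by (induction F rule: infinite_finite_induct) (simp_all add: cinner_add_left)

lemma cinner_sum_right: "cinner x (\<Sum>i\<in>F. f i) = (\<Sum>i\<in>F. cinner x (f i))"
  by (induction F rule: infinite_finite_induct) (simp_all add: cinner_add_right)

lemma cinner_self: "cinner x x = complex_of_real ((norm x)\<^sup>2)"
proof -
  have "Im (cinner x x) = 0"
    using cinner_commute [of x x] by (metis cnj.simps(2) neg_equal_zero)
  moreover have "Re (cinner x x) = (norm x)\<^sup>2"
    by (simp add: norm_eq_sqrt_cinner cinner_ge_zero)
  ultimately show ?thesis
    by (simp add: complex_eq_iff)
qed

lemma norm_cinner_le: "norm (cinner x y) \<le> norm x * norm y"
proof (cases "y = 0")
  case False
  let ?n = "complex_of_real ((norm y)\<^sup>2)"
  \<comment> \<open>Up to the factor \<open>(norm y)\<^sup>2\<close>, \<open>z\<close> is the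
    component of \<open>x\<close> orthogonal to \<open>y\<close>; this scaling avoids
    division.\<close>
  define z where "z = ?n *\<^sub>C x - cinner x y *\<^sub>C y"
  have "cinner z y = 0"
    by (simp add: z_def cinner_diff_left cinner_scaleC_left cinner_self)
  then have "cinner z z = ?n * cinner z x"
    unfolding z_def by (simp add: cinner_diff_right cinner_scaleC_right)
  also have "cinner z x = ?n * cinner x x - cinner x y * cnj (cinner x y)"
    unfolding z_def by (simp add: cinner_diff_left cinner_scaleC_left flip: cinner_commute)
  also have "\<dots> = complex_of_real ((norm y)\<^sup>2 * (norm x)\<^sup>2 - (norm (cinner x y))\<^sup>2)"
    by (simp add: cinner_self flip: complex_norm_square)
  finally have "cinner z z = complex_of_real ((norm y)\<^sup>2 * ((norm y)\<^sup>2 * (norm x)\<^sup>2 - (norm (cinner x y))\<^sup>2))"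
    by simp
  then have "0 \<le> (norm y)\<^sup>2 * ((norm y)\<^sup>2 * (norm x)\<^sup>2 - (norm (cinner x y))\<^sup>2)"
    using cinner_ge_zero [of z] by simp
  then have "(norm (cinner x y))\<^sup>2 \<le> (norm x * norm y)\<^sup>2"
    using False by (simp add: zero_le_mult_iff power_mult_distrib mult.commute)
  then show ?thesis
    by (rule power2_le_imp_le) simp
qed simp

lemma bounded_linear_cinner_left: "bounded_linear (\<lambda>x. cinner x y)"
  by (rule bounded_linear_intro [where K = "norm y"])
    (simp_all add: cinner_add_left cinner_scaleC_left scaleR_scaleC norm_cinner_le scaleC_complex_def)

lemma has_sum_cinner_left:
  assumes "(f has_sum s) I"
  shows "((\<lambda>i. cinner (f i) y) has_sum cinner s y) I"
  using has_sum_bounded_linear [OF bounded_linear_cinner_left assms] .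

section \<open>Orthonormal systems\<close>

text \<open>Density of the span is left out so that the property passes to the finite index sets of
  partial sums.\<close>

definition orthonormal_system :: "'i set \<Rightarrow> ('i \<Rightarrow> 'a::complex_inner) \<Rightarrow> bool"
  where "orthonormal_system I e \<longleftrightarrow>
    (\<forall>\<xi>\<in>I. \<forall>\<eta>\<in>I. cinner (e \<xi>) (e \<eta>) = (if \<xi> = \<eta> then 1 else 0))"

lemma orthonormal_system_mono: "orthonormal_system I e \<Longrightarrow> F \<subseteq> I \<Longrightarrow> orthonormal_system F e"
  by (simp add: orthonormal_system_def subset_iff)

lemma orthonormal_basis_imp_system: "orthonormal_basis I e \<Longrightarrow> orthonormal_system I e"
  by (simp add: orthonormal_basis_def orthonormal_system_def)

lemma orthonormal_cinner_sum:
  assumes "orthonormal_system F e" "finite F" "\<eta> \<in> F"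
  shows "cinner (\<Sum>\<xi>\<in>F. c \<xi> *\<^sub>C e \<xi>) (e \<eta>) = c \<eta>"
proof -
  have "cinner (\<Sum>\<xi>\<in>F. c \<xi> *\<^sub>C e \<xi>) (e \<eta>) = (\<Sum>\<xi>\<in>F. if \<xi> = \<eta> then c \<xi> else 0)"
    unfolding cinner_sum_left
    using assms by (intro sum.cong) (auto simp: cinner_scaleC_left orthonormal_system_def)
  then show ?thesis
    using assms by simp
qed

lemma orthonormal_norm_sum:
  assumes "orthonormal_system F e" "finite F"
  shows "(norm (\<Sum>\<xi>\<in>F. c \<xi> *\<^sub>C e \<xi>))\<^sup>2 = (\<Sum>\<xi>\<in>F. (norm (c \<xi>))\<^sup>2)"
proof -
  let ?w = "\<Sum>\<xi>\<in>F. c \<xi> *\<^sub>C e \<xi>"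
  have "cinner ?w ?w = (\<Sum>\<eta>\<in>F. cnj (c \<eta>) * cinner ?w (e \<eta>))"
    by (simp add: cinner_sum_right [of ?w] cinner_scaleC_right)
  also have "\<dots> = (\<Sum>\<eta>\<in>F. complex_of_real ((norm (c \<eta>))\<^sup>2))"
    by (intro sum.cong refl)
      (simp add: orthonormal_cinner_sum [OF assms] complex_norm_square mult.commute del: of_real_power)
  finally have "complex_of_real ((norm ?w)\<^sup>2) = complex_of_real (\<Sum>\<eta>\<in>F. (norm (c \<eta>))\<^sup>2)"
    by (simp only: cinner_self of_real_sum)
  then show ?thesis
    by (simp only: of_real_eq_iff)
qed

text \<open>The residual is orthogonal to the projection, so Pythagoras applies. The constant 1 is
  uniform in \<open>F\<close>, which is what carries the expansion from the span to its
  closure.\<close>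

lemma orthonormal_residual_le:
  assumes "orthonormal_system F e" "finite F"
  shows "norm (x - (\<Sum>\<xi>\<in>F. cinner x (e \<xi>) *\<^sub>C e \<xi>)) \<le> norm x"
proof -
  define p where "p = (\<Sum>\<xi>\<in>F. cinner x (e \<xi>) *\<^sub>C e \<xi>)"
  have "cinner (x - p) (e \<xi>) = 0" if "\<xi> \<in> F" for \<xi>
    using orthonormal_cinner_sum [OF assms that] by (simp add: cinner_diff_left p_def)
  then have orth: "cinner (x - p) p = 0"
    by (subst (2) p_def) (simp add: cinner_sum_right cinner_scaleC_right)
  then have orth': "cinner p (x - p) = 0"
    by (subst cinner_commute) simp
  have "cinner x x = cinner (p + (x - p)) (p + (x - p))"
    by simp
  also have "\<dots> = cinner p p + cinner (x - p) (x - p)"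
    by (simp only: cinner_add_left cinner_add_right orth orth' add_0_left add_0_right)
  finally have "complex_of_real ((norm x)\<^sup>2) = complex_of_real ((norm p)\<^sup>2 + (norm (x - p))\<^sup>2)"
    by (simp only: cinner_self of_real_add)
  then have "(norm x)\<^sup>2 = (norm p)\<^sup>2 + (norm (x - p))\<^sup>2"
    by (simp only: of_real_eq_iff)
  then have "norm (x - p) \<le> norm x"
    by (simp add: power2_le_imp_le)
  then show ?thesis
    by (simp only: p_def)
qed

text \<open>A vector of the span involves finitely many basis vectors; as soon as \<open>F\<close>
  contains their indices, the projection attached to \<open>F\<close> fixes it. The induction
  collects these indices in \<open>F0\<close>.\<close>

lemma orthonormal_span_expansion:
  assumes "orthonormal_system I e" "y \<in> complex_vector.span (e ` I)"
  shows "\<exists>F0. finite F0 \<and> F0 \<subseteq> I \<and>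
    (\<forall>F. finite F \<longrightarrow> F0 \<subseteq> F \<longrightarrow> F \<subseteq> I \<longrightarrow> (\<Sum>\<xi>\<in>F. cinner y (e \<xi>) *\<^sub>C e \<xi>) = y)"
  using assms(2)
proof (induction rule: complex_vector.span_induct_alt)
  case base
  then show ?case
    by (intro exI [of _ "{}"]) simp
next
  case (step c x y)
  from step(1) obtain \<eta> where \<eta>: "\<eta> \<in> I" "x = e \<eta>"
    by blast
  from step(2) obtain F0 where F0: "finite F0" "F0 \<subseteq> I"
    "\<And>F. finite F \<Longrightarrow> F0 \<subseteq> F \<Longrightarrow> F \<subseteq> I \<Longrightarrow> (\<Sum>\<xi>\<in>F. cinner y (e \<xi>) *\<^sub>C e \<xi>) = y"
    by blast
  have "(\<Sum>\<xi>\<in>F. cinner (c *\<^sub>C x + y) (e \<xi>) *\<^sub>C e \<xi>) = c *\<^sub>C x + y"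
    if F: "finite F" "insert \<eta> F0 \<subseteq> F" "F \<subseteq> I" for F
  proof -
    have "(\<Sum>\<xi>\<in>F. cinner x (e \<xi>) *\<^sub>C e \<xi>) = (\<Sum>\<xi>\<in>F. if \<xi> = \<eta> then e \<xi> else 0)"
      using assms(1) \<eta> F by (intro sum.cong) (auto simp: orthonormal_system_def scaleC_one)
    also have "\<dots> = x"
      using F \<eta> by simp
    finally have "(\<Sum>\<xi>\<in>F. cinner x (e \<xi>) *\<^sub>C e \<xi>) = x" .
    moreover have "(\<Sum>\<xi>\<in>F. cinner (c *\<^sub>C x + y) (e \<xi>) *\<^sub>C e \<xi>) =
        c *\<^sub>C (\<Sum>\<xi>\<in>F. cinner x (e \<xi>) *\<^sub>C e \<xi>) + (\<Sum>\<xi>\<in>F. cinner y (e \<xi>) *\<^sub>C e \<xi>)"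
      by (simp only: cinner_add_left cinner_scaleC_left scaleC_add_left sum.distrib
          scaleC_scaleC complex_vector.scale_sum_right)
    ultimately show ?thesis
      using F0(3) [of F] F by simp
  qed
  then show ?case
    using F0 \<eta> by (intro exI [of _ "insert \<eta> F0"]) simp
qed

text \<open>Partial sums are eventually exact on the dense span, and the residual bound keeps the
  error at \<open>x\<close> below the distance to an approximant there.\<close>

lemma has_sum_orthonormal_basis:
  assumes "orthonormal_basis I e"
  shows "((\<lambda>\<xi>. cinner x (e \<xi>) *\<^sub>C e \<xi>) has_sum x) I"
  unfolding has_sum_def
proof (rule tendstoI)
  fix \<epsilon> :: real
  assume "\<epsilon> > 0"
  let ?P = "\<lambda>F x. \<Sum>\<xi>\<in>F. cinner x (e \<xi>) *\<^sub>C e \<xi>"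
  have on: "orthonormal_system I e"
    using assms by (rule orthonormal_basis_imp_system)
  have "x \<in> closure (complex_vector.span (e ` I))"
    using assms by (simp add: orthonormal_basis_def)
  then obtain y where y: "y \<in> complex_vector.span (e ` I)" "dist y x < \<epsilon>"
    using \<open>\<epsilon> > 0\<close> closure_approachable by blast
  from orthonormal_span_expansion [OF on y(1)]
  obtain F0 where F0: "finite F0" "F0 \<subseteq> I"
    and P: "\<And>F. finite F \<Longrightarrow> F0 \<subseteq> F \<Longrightarrow> F \<subseteq> I \<Longrightarrow> ?P F y = y"
    by blast
  have "dist (?P F x) x < \<epsilon>" if F: "finite F" "F0 \<subseteq> F" "F \<subseteq> I" for F
  proof -
    have "?P F (x - y) = ?P F x - y"
      using P [OF F]
      by (simp add: cinner_diff_left complex_vector.scale_left_diff_distrib sum_subtractf)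
    \<comment> \<open>The partial sum fixes \<open>y\<close>, so \<open>y\<close> cancels from the
      residual.\<close>
    then have residual: "x - ?P F x = (x - y) - ?P F (x - y)"
      by simp
    have "norm (x - ?P F x) \<le> norm (x - y)"
      unfolding residual
      by (rule orthonormal_residual_le [OF orthonormal_system_mono [OF on F(3)] F(1)])
    then show ?thesis
      using y(2) by (simp add: dist_norm norm_minus_commute)
  qed
  then show "\<forall>\<^sub>F F in finite_subsets_at_top I. dist (?P F x) x < \<epsilon>"
    using F0 by (auto simp: eventually_finite_subsets_at_top)
qed

section \<open>Unconditional convergence\<close>

text \<open>Cauchy criterion over finite subsets: the difference of nested partial sums is again a
  finite sum, controlled by a tail of \<open>q\<close>. The norms of the terms themselves need not
  be summable.\<close>

lemma summable_on_norm_sum_le_sqrt: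
  fixes f :: "'i \<Rightarrow> 'b::{real_normed_vector, complete_space}" and q :: "'i \<Rightarrow> real"
  assumes le: "\<And>F. finite F \<Longrightarrow> F \<subseteq> I \<Longrightarrow> norm (sum f F) \<le> C * sqrt (sum q F)"
    and C: "C \<ge> 0" and q: "q summable_on I"
  shows "f summable_on I"
proof -
  have "\<exists>P. eventually P (finite_subsets_at_top I) \<and>
      (\<forall>F G. P F \<and> P G \<longrightarrow> dist (sum f F) (sum f G) < \<epsilon>)" if "\<epsilon> > 0" for \<epsilon> :: real
  proof -
    \<comment> \<open>\<open>C + 1\<close> in place of \<open>C\<close> covers the case
      \<open>C = 0\<close>.\<close>
    define r where "r = \<epsilon> / (2 * (C + 1))"
    have r: "r > 0" "C * r < \<epsilon> / 2"
      using that C by (simp_all add: r_def field_simps)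
    obtain L where "(q has_sum L) I"
      using q by (auto simp: summable_on_def)
    \<comment> \<open>Two partial sums within \<open>r\<^sup>2 / 2\<close> of \<open>L\<close>
      differ by at most \<open>r\<^sup>2\<close>, whose square root is \<open>r\<close>.\<close>
    then have "\<forall>\<^sub>F F in finite_subsets_at_top I. dist (sum q F) L < r\<^sup>2 / 2"
      unfolding has_sum_def using r(1) by (intro tendstoD) simp_all
    then obtain F0 where F0: "finite F0" "F0 \<subseteq> I"
      and L: "\<And>F. finite F \<Longrightarrow> F0 \<subseteq> F \<Longrightarrow> F \<subseteq> I \<Longrightarrow> dist (sum q F) L < r\<^sup>2 / 2"
      by (auto simp: eventually_finite_subsets_at_top)
    have near: "dist (sum f F) (sum f F0) < \<epsilon> / 2" if F: "finite F" "F0 \<subseteq> F" "F \<subseteq> I" for F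
    proof -
      have "sum q (F - F0) = sum q F - sum q F0"
        using F F0 by (simp add: sum_diff)
      also have "\<dots> \<le> r\<^sup>2"
        using L [OF F] L [OF F0(1) order_refl F0(2)] unfolding dist_real_def by linarith
      finally have "sqrt (sum q (F - F0)) \<le> r"
        using r(1) by (intro real_le_lsqrt) simp_all
      moreover have "dist (sum f F) (sum f F0) = norm (sum f (F - F0))"
        using F F0 by (simp add: sum_diff dist_norm)
      moreover have "\<dots> \<le> C * sqrt (sum q (F - F0))"
        using F by (intro le) auto
      ultimately show ?thesis
        using r(2) mult_left_mono [of "sqrt (sum q (F - F0))" r C] C by linarith
    qed
    let ?P = "\<lambda>F. dist (sum f F) (sum f F0) < \<epsilon> / 2"
    have "eventually ?P (finite_subsets_at_top I)"
      using near F0 by (auto simp: eventually_finite_subsets_at_top)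
    moreover have "dist (sum f F) (sum f G) < \<epsilon>" if "?P F \<and> ?P G" for F G
      using that dist_triangle_half_l [of "sum f F" "sum f F0" \<epsilon> "sum f G"] by simp
    ultimately show ?thesis
      by blast
  qed
  then have "cauchy_filter (filtermap (sum f) (finite_subsets_at_top I))"
    by (simp add: cauchy_filter_metric_filtermap)
  moreover have "complete (UNIV :: 'b set)"
    by (meson Cauchy_convergent UNIV_I complete_def convergent_def)
  ultimately obtain s where "(sum f \<longlongrightarrow> s) (finite_subsets_at_top I)"
    using complete_uniform [where S = UNIV] by (force simp: filterlim_def)
  then show ?thesis
    by (auto simp: summable_on_def has_sum_def)
qed

section \<open>Biorthogonal systems and Riesz bases\<close>

lemma biorthogonal_sym: "biorthogonal I u v \<Longrightarrow> biorthogonal I v u"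
  unfolding biorthogonal_def
  by (metis cinner_commute complex_cnj_one complex_cnj_zero)

lemma biorthogonal_has_sum_coeff:
  assumes "biorthogonal I u v" "((\<lambda>\<xi>. c \<xi> *\<^sub>C u \<xi>) has_sum x) I" "\<eta> \<in> I"
  shows "cinner x (v \<eta>) = c \<eta>"
proof -
  have "((\<lambda>\<xi>. cinner (c \<xi> *\<^sub>C u \<xi>) (v \<eta>)) has_sum cinner x (v \<eta>)) I"
    using assms(2) by (rule has_sum_cinner_left)
  \<comment> \<open>Biorthogonality kills every term except the one at
    \<open>\<eta>\<close>.\<close>
  also have "?this \<longleftrightarrow> (c has_sum cinner x (v \<eta>)) {\<eta>}"
    using assms(1,3)
    by (intro has_sum_cong_neutral) (auto simp: cinner_scaleC_left biorthogonal_def)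
  finally show ?thesis
    using has_sum_unique has_sum_finite [of "{\<eta>}" c] by fastforce
qed

text \<open>The witnesses behind \<open>riesz_basis\<close> become parameters, so that estimates can
  refer to \<open>onorm S\<close> and \<open>onorm T\<close>.\<close>

locale riesz_biorthogonal =
  fixes I :: "'i set" and u v e :: "'i \<Rightarrow> 'a::chilbert_space" and T S :: "'a \<Rightarrow> 'a"
  assumes onb: "orthonormal_basis I e"
    and T: "bounded_clinear T" and S: "bounded_clinear S"
    and TS: "T (S x) = x"
    and u_eq: "\<xi> \<in> I \<Longrightarrow> u \<xi> = T (e \<xi>)"
    and biorth: "biorthogonal I u v"
begin

lemma has_sum_orthonormal_u: "((\<lambda>\<xi>. cinner (S f) (e \<xi>) *\<^sub>C u \<xi>) has_sum f) I"
proof -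
  have "((\<lambda>\<xi>. T (cinner (S f) (e \<xi>) *\<^sub>C e \<xi>)) has_sum T (S f)) I"
    using T by (intro has_sum_bounded_linear [OF _ has_sum_orthonormal_basis [OF onb]])
      (simp add: bounded_clinear_def)
  then show ?thesis
    unfolding TS using T by (simp add: bounded_clinear_def u_eq cong: has_sum_cong)
qed

text \<open>Coefficients along \<open>u\<close> are determined by biorthogonality. In effect
  \<open>v \<eta>\<close> is the adjoint of \<open>S\<close> applied to \<open>e \<eta>\<close>, but
  no adjoint is constructed.\<close>

lemma cinner_v: "\<eta> \<in> I \<Longrightarrow> cinner f (v \<eta>) = cinner (S f) (e \<eta>)"
  using biorthogonal_has_sum_coeff [OF biorth has_sum_orthonormal_u] .

lemma has_sum_u: "((\<lambda>\<xi>. cinner f (v \<xi>) *\<^sub>C u \<xi>) has_sum f) I"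
  using has_sum_orthonormal_u by (simp add: cinner_v cong: has_sum_cong)

text \<open>Moving \<open>S\<close> across the inner product gives
  \<open>(norm ?h)\<^sup>2 = norm (cinner (S ?h) ?w)\<close>; Cauchy-Schwarz and boundedness of
  \<open>S\<close> then leave one factor \<open>norm ?h\<close> to cancel.\<close>

lemma norm_sum_v_le:
  assumes "finite F" "F \<subseteq> I"
  shows "norm (\<Sum>\<xi>\<in>F. c \<xi> *\<^sub>C v \<xi>) \<le> onorm S * sqrt (\<Sum>\<xi>\<in>F. (norm (c \<xi>))\<^sup>2)"
proof -
  let ?h = "\<Sum>\<xi>\<in>F. c \<xi> *\<^sub>C v \<xi>" and ?w = "\<Sum>\<xi>\<in>F. c \<xi> *\<^sub>C e \<xi>"
  have on: "orthonormal_system F e"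
    using onb assms orthonormal_basis_imp_system orthonormal_system_mono by blast
  have w: "norm ?w = sqrt (\<Sum>\<xi>\<in>F. (norm (c \<xi>))\<^sup>2)"
    using orthonormal_norm_sum [OF on assms(1), of c] by (simp add: real_sqrt_unique)
  have "cinner ?h ?h = (\<Sum>\<xi>\<in>F. cnj (c \<xi>) * cinner ?h (v \<xi>))"
    by (simp add: cinner_sum_right [of ?h] cinner_scaleC_right)
  also have "\<dots> = (\<Sum>\<xi>\<in>F. cnj (c \<xi>) * cinner (S ?h) (e \<xi>))"
    using assms by (intro sum.cong refl) (auto simp: cinner_v)
  also have "\<dots> = cinner (S ?h) ?w"
    by (simp add: cinner_sum_right [of "S ?h"] cinner_scaleC_right)
  finally have "(norm ?h)\<^sup>2 = norm (cinner (S ?h) ?w)"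
    by (metis cinner_self norm_of_real abs_power2)
  also have "\<dots> \<le> norm (S ?h) * norm ?w"
    by (rule norm_cinner_le)
  also have "\<dots> \<le> (onorm S * norm ?h) * norm ?w"
    using S by (intro mult_right_mono onorm) (simp_all add: bounded_clinear_def)
  finally have "norm ?h * norm ?h \<le> norm ?h * (onorm S * norm ?w)"
    by (simp add: power2_eq_square mult_ac)
  then have "norm ?h \<le> onorm S * norm ?w"
    using S by (cases "norm ?h = 0")
      (auto simp: bounded_clinear_def onorm_pos_le mult_le_cancel_left)
  then show ?thesis
    by (simp only: w)
qed

text \<open>A Bessel inequality for \<open>u\<close>: testing \<open>f\<close> against
  \<open>T ?w\<close>, built from the coefficients of \<open>f\<close> itself, reproduces their
  square sum \<open>(norm ?w)\<^sup>2\<close>, and one factor \<open>norm ?w\<close>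
  cancels.\<close>

lemma sum_norm_cinner_u_le:
  assumes "finite F" "F \<subseteq> I"
  shows "(\<Sum>\<xi>\<in>F. (norm (cinner f (u \<xi>)))\<^sup>2) \<le> (onorm T * norm f)\<^sup>2"
proof -
  let ?c = "\<lambda>\<xi>. cinner f (u \<xi>)"
  let ?w = "\<Sum>\<xi>\<in>F. ?c \<xi> *\<^sub>C e \<xi>"
  have on: "orthonormal_system F e"
    using onb assms orthonormal_basis_imp_system orthonormal_system_mono by blast
  have w: "(norm ?w)\<^sup>2 = (\<Sum>\<xi>\<in>F. (norm (?c \<xi>))\<^sup>2)"
    using orthonormal_norm_sum [OF on assms(1)] .
  have linT: "linear T"
    using T by (simp add: bounded_clinear_def bounded_linear.linear)
  have Tw: "T ?w = (\<Sum>\<xi>\<in>F. ?c \<xi> *\<^sub>C u \<xi>)"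
    using T assms by (auto simp: linear_sum [OF linT] bounded_clinear_def u_eq intro!: sum.cong)
  have "cinner f (T ?w) = (\<Sum>\<xi>\<in>F. complex_of_real ((norm (?c \<xi>))\<^sup>2))"
    unfolding Tw cinner_sum_right cinner_scaleC_right
    by (intro sum.cong refl) (simp add: complex_norm_square mult.commute del: of_real_power)
  also have "\<dots> = complex_of_real ((norm ?w)\<^sup>2)"
    by (simp only: w of_real_sum)
  finally have "(norm ?w)\<^sup>2 = norm (cinner f (T ?w))"
    by (metis norm_of_real abs_power2)
  also have "\<dots> \<le> norm f * norm (T ?w)"
    by (rule norm_cinner_le)
  also have "\<dots> \<le> norm f * (onorm T * norm ?w)"
    using T by (intro mult_left_mono onorm) (simp_all add: bounded_clinear_def)
  finally have "norm ?w * norm ?w \<le> norm ?w * (onorm T * norm f)"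
    by (simp add: power2_eq_square mult_ac)
  then have "norm ?w \<le> onorm T * norm f"
    using T by (cases "norm ?w = 0")
      (auto simp: bounded_clinear_def onorm_pos_le mult_le_cancel_left)
  then show ?thesis
    unfolding w [symmetric] by (intro power_mono) simp_all
qed

lemma has_sum_v: "((\<lambda>\<xi>. cinner f (u \<xi>) *\<^sub>C v \<xi>) has_sum f) I"
proof -
  have "(\<lambda>\<xi>. (norm (cinner f (u \<xi>)))\<^sup>2) summable_on I"
    using sum_norm_cinner_u_le by (intro nonneg_bdd_above_summable_on bdd_aboveI2) auto
  then have "(\<lambda>\<xi>. cinner f (u \<xi>) *\<^sub>C v \<xi>) summable_on I"
    using S by (intro summable_on_norm_sum_le_sqrt [OF norm_sum_v_le])
      (simp_all add: onorm_pos_le bounded_clinear_def)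
  then obtain h where h: "((\<lambda>\<xi>. cinner f (u \<xi>) *\<^sub>C v \<xi>) has_sum h) I"
    by (auto simp: summable_on_def)
  \<comment> \<open>By the expansion along \<open>u\<close>, a vector orthogonal to every \<open>u \<eta>\<close> is orthogonal to itself.\<close>
  have orth: "cinner (u \<eta>) (h - f) = 0" if "\<eta> \<in> I" for \<eta>
    using biorthogonal_has_sum_coeff [OF biorthogonal_sym [OF biorth] h that]
    by (simp add: cinner_commute [of "u \<eta>"] cinner_diff_left)
  have "((\<lambda>\<xi>. cinner (cinner (h - f) (v \<xi>) *\<^sub>C u \<xi>) (h - f)) has_sum cinner (h - f) (h - f)) I"
    by (rule has_sum_cinner_left [OF has_sum_u])
  then have "((\<lambda>\<xi>. 0) has_sum cinner (h - f) (h - f)) I"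
    by (simp add: cinner_scaleC_left orth cong: has_sum_cong)
  then have "cinner (h - f) (h - f) = 0"
    by (rule has_sum_unique) (simp add: has_sum_0)
  then have "h = f"
    by (simp add: cinner_self)
  then show ?thesis
    using h by simp
qed

end

section \<open>Expansions along both systems and the Parseval identity\<close>

lemma riesz_basis_has_sum:
  fixes u :: "'i \<Rightarrow> 'a::chilbert_space"
  assumes "riesz_basis I u" "biorthogonal I u v"
  shows "((\<lambda>\<xi>. coeff_along v f \<xi> *\<^sub>C u \<xi>) has_sum f) I"
    and "((\<lambda>\<xi>. coeff_along u f \<xi> *\<^sub>C v \<xi>) has_sum f) I"
proof -
  obtain e :: "'i \<Rightarrow> 'a" and T S where *: "orthonormal_basis I e" "bounded_clinear T"
    "bounded_clinear S" "T \<circ> S = id" "\<forall>\<xi>\<in>I. u \<xi> = T (e \<xi>)"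
    using assms(1) unfolding riesz_basis_def by blast
  interpret riesz_biorthogonal I u v e T S
    using * assms(2) by unfold_locales (simp_all add: fun_eq_iff)
  show "((\<lambda>\<xi>. coeff_along v f \<xi> *\<^sub>C u \<xi>) has_sum f) I"
    and "((\<lambda>\<xi>. coeff_along u f \<xi> *\<^sub>C v \<xi>) has_sum f) I"
    unfolding coeff_along_def by (rule has_sum_u has_sum_v)+
qed

text \<open>Pairs the expansion of \<open>f\<close> termwise with \<open>g\<close>. Only the
  expansion is assumed, so \<open>u\<close> and \<open>v\<close> may be exchanged.\<close>

lemma has_sum_coeff_along_mult_cnj:
  assumes "((\<lambda>\<xi>. coeff_along v f \<xi> *\<^sub>C u \<xi>) has_sum f) I"
  shows "((\<lambda>\<xi>. coeff_along v f \<xi> * cnj (coeff_along u g \<xi>)) has_sum cinner f g) I"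
  using has_sum_cinner_left [OF assms, of g]
  by (simp add: cinner_scaleC_left coeff_along_def flip: cinner_commute)

text \<open>By the expansion of \<open>g\<close>, \<open>synthesis\<close> undoes the coefficient
  map, so the second factor in \<open>l2_inner\<close> is \<open>coeff_along u g\<close>; the
  expansion of \<open>f\<close> then gives the sum.\<close>

lemma l2_inner_coeff_along:
  assumes "\<And>f. ((\<lambda>\<xi>. coeff_along v f \<xi> *\<^sub>C u \<xi>) has_sum f) I"
  shows "l2_inner I u (coeff_along v f) (coeff_along v g) = cinner f g"
proof -
  have "synthesis I u (coeff_along v g) = g"
    unfolding synthesis_def by (rule infsumI [OF assms])
  then show ?thesis
    unfolding l2_inner_def using infsumI [OF has_sum_coeff_along_mult_cnj [OF assms]] by simp
qed

theorem theorem3p1: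
  fixes I :: "'i set"
    and u v :: "'i \<Rightarrow> 'a::chilbert_space"
    and f g :: 'a
  assumes separable: "separable_space (euclidean :: 'a topology)"
    and countable: "countable I"
    and riesz: "riesz_basis I u"
    and biorth: "biorthogonal I u v"
  shows "(coeff_along v f \<in> l2_space I u \<and> coeff_along v g \<in> l2_space I u \<and>
          coeff_along u f \<in> l2_space I v \<and> coeff_along u g \<in> l2_space I v) \<and>
    ((\<lambda>\<xi>. coeff_along v f \<xi> * cnj (coeff_along u g \<xi>)) has_sum
       l2_inner I u (coeff_along v f) (coeff_along v g)) I \<and>
    ((\<lambda>\<xi>. coeff_along u f \<xi> * cnj (coeff_along v g \<xi>)) has_sum
       l2_inner I v (coeff_along u f) (coeff_along u g)) I \<and>
    cnj (l2_inner I u (coeff_along v f) (coeff_along v g)) =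
      l2_inner I v (coeff_along u g) (coeff_along u f) \<and>
    (cinner f g = l2_inner I u (coeff_along v f) (coeff_along v g) \<and>
     ((\<lambda>\<xi>. coeff_along v f \<xi> * cnj (coeff_along u g \<xi>)) has_sum cinner f g) I) \<and>
    (norm f = l2_norm I u (coeff_along v f) \<and>
     l2_norm I u (coeff_along v f) = l2_norm I v (coeff_along u f))"
proof -
  note u = riesz_basis_has_sum(1) [OF riesz biorth]
    and v = riesz_basis_has_sum(2) [OF riesz biorth]
  \<comment> \<open>Every \<open>l2_inner\<close> reduces to an inner product of the Hilbert space,
    so the conjugation and norm identities become those of \<open>cinner\<close>.\<close>
  show ?thesis
    using has_sum_coeff_along_mult_cnj [OF u] has_sum_coeff_along_mult_cnj [OF v]
    by (simp add: l2_space_def l2_norm_def l2_inner_coeff_along u v norm_eq_sqrt_cinner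
        has_sum_imp_summable [OF u] has_sum_imp_summable [OF v] flip: cinner_commute)
qed

end
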